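(* Let $\Omega\subset\mathbb{R}^2$ be a domain, let $\Gamma\subset\Omega$ be a connected piece of a parabola, and let $\tau$ and $T$ be open curves (nonempty, connected, relatively open pieces of $\Gamma$) with $\tau\subset T\subset\subset\Gamma$. Let $u\in C^2(\Omega)$ be harmonic in $\Omega$ with $\|u\|_{C(\Omega)}\le M$ for some constant $M>0$. If $u|_{\tau}=0$, then $u|_{T}\equiv 0$.
   Context: $\|u\|_{C(\Omega)}=\sup_{\mathbf{x}\in\Omega}|u(\mathbf{x})|$. $T\subset\subset\Gamma$ means that the closure of $T$ is compact and contained in $\Gamma$. *)

theory Defs
  imports "HOL-Analysis.Analysis"
begin

text \<open>
  Functions on a subset of \<open>\<real>\<^sup>n\<close> are total functions of which only the values on that set matter.
  The notions below look at \<open>u\<close> in a neighbourhood of each point, so \<open>Ck_on\<close> and \<open>harmonic_on\<close>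
  are meant for open \<open>S\<close>.
\<close>

definition has_partial_at :: "'n::finite \<Rightarrow> (real^'n \<Rightarrow> real) \<Rightarrow> real^'n \<Rightarrow> bool" where
  "has_partial_at i u x \<longleftrightarrow> (\<lambda>t. u (x + t *\<^sub>R axis i 1)) differentiable at (0::real)"

definition partial :: "'n::finite \<Rightarrow> (real^'n \<Rightarrow> real) \<Rightarrow> real^'n \<Rightarrow> real" where
  "partial i u x = deriv (\<lambda>t. u (x + t *\<^sub>R axis i 1)) (0::real)"

primrec Ck_on :: "nat \<Rightarrow> (real^'n::finite \<Rightarrow> real) \<Rightarrow> (real^'n) set \<Rightarrow> bool" where
  "Ck_on 0 u S \<longleftrightarrow> continuous_on S u"
| "Ck_on (Suc k) u S \<longleftrightarrow> continuous_on S u \<and>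
     (\<forall>i. (\<forall>x\<in>S. has_partial_at i u x) \<and> Ck_on k (partial i u) S)"

definition laplacian :: "(real^'n::finite \<Rightarrow> real) \<Rightarrow> real^'n \<Rightarrow> real" where
  "laplacian u x = (\<Sum>i\<in>UNIV. partial i (partial i u) x)"

definition harmonic_on :: "(real^'n::finite \<Rightarrow> real) \<Rightarrow> (real^'n) set \<Rightarrow> bool" where
  "harmonic_on u S \<longleftrightarrow> Ck_on 2 u S \<and> (\<forall>x\<in>S. laplacian u x = 0)"

text \<open>
  The supremum is taken in the extended reals, since a real-valued \<open>Sup\<close> has an unspecified value
  on an unbounded set; a finite upper bound therefore does imply boundedness of \<open>u\<close> on \<open>S\<close>.
\<close>

definition C_norm :: "(real^'n::finite) set \<Rightarrow> (real^'n \<Rightarrow> real) \<Rightarrow> ereal" where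
  "C_norm S u = (SUP x\<in>S. ereal \<bar>u x\<bar>)"

text \<open>Focus \<open>F\<close>, directrix \<open>L\<close> not passing through \<open>F\<close>.\<close>

definition parabola :: "(real^2) set \<Rightarrow> bool" where
  "parabola P \<longleftrightarrow> (\<exists>F L. affine L \<and> aff_dim L = 1 \<and> F \<notin> L \<and> P = {x. dist x F = infdist x L})"

definition connected_piece_of_parabola :: "(real^2) set \<Rightarrow> bool" where
  "connected_piece_of_parabola \<Gamma> \<longleftrightarrow> \<Gamma> \<noteq> {} \<and> connected \<Gamma> \<and> (\<exists>P. parabola P \<and> \<Gamma> \<subseteq> P)"

definition open_curve_in :: "(real^2) set \<Rightarrow> (real^2) set \<Rightarrow> bool" where
  "open_curve_in T \<Gamma> \<longleftrightarrow> T \<noteq> {} \<and> connected T \<and> openin (top_of_set \<Gamma>) T"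

definition compactly_contained :: "'a::topological_space set \<Rightarrow> 'a set \<Rightarrow> bool" where
  "compactly_contained T \<Gamma> \<longleftrightarrow> compact (closure T) \<and> closure T \<subseteq> \<Gamma>"

end

theory Submission
  imports Defs "HOL-Complex_Analysis.Conformal_Mappings"
begin

text \<open>
  A harmonic function is real analytic, so its restriction to a parabola, parametrized by a
  quadratic polynomial, is a real analytic function of one variable. Such a function cannot have an
  accumulation point of zeros without vanishing near that point, and a connected parameter range
  then propagates the zeros from \<open>\<tau>\<close> to the whole of \<open>\<Gamma>\<close>, in particular to \<open>T\<close>.

  Analyticity enters through complex analysis. Identify the plane with \<open>\<complex>\<close>. On a small rectangle
  a harmonic \<open>u\<close> has a conjugate, given by explicit integrals of its first partial derivatives,
  so that \<open>u = Re F\<close> with \<open>F\<close> holomorphic (\<open>harmonic_locally_Re_holomorphic\<close>). If \<open>\<gamma>\<close> is an entire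
  function whose restriction to the real line is the curve, then \<open>2 u(\<gamma>(t))\<close> for real \<open>t\<close> is the
  restriction of \<open>F(\<gamma>(z)) + cnj (F(\<gamma>(cnj z)))\<close>, which is holomorphic near each real parameter whose
  image lies in the rectangle. The identity theorem for holomorphic functions thus shows that an
  accumulation of zeros of \<open>u\<close> along \<open>\<gamma>\<close> forces \<open>u\<close> to vanish on a whole parameter interval
  (\<open>harmonic_zero_along_analytic_curve\<close>).

  A parabola is the image of such a curve, of degree two, and the parameter of a point is a continuous
  function of the point: it is the coordinate parallel to the directrix
  (\<open>parabola_parametrization\<close>). The set of points of \<open>\<Gamma>\<close> near which \<open>u\<close> vanishes on \<open>\<Gamma>\<close> is
  open in \<open>\<Gamma>\<close> by construction, closed by the accumulation argument, and contains \<open>\<tau>\<close>. Since \<open>\<Gamma>\<close> is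
  connected, this set is \<open>\<Gamma>\<close>.
\<close>

section \<open>Harmonic conjugates\<close>

lemma has_derivative_of_continuous_partials:
  fixes f :: "real \<Rightarrow> real \<Rightarrow> real"
  assumes fx: "\<And>x y. x \<in> {a<..<b} \<Longrightarrow> y \<in> {c<..<d} \<Longrightarrow> ((\<lambda>x. f x y) has_real_derivative fx x y) (at x)"
    and fy: "\<And>x y. x \<in> {a<..<b} \<Longrightarrow> y \<in> {c<..<d} \<Longrightarrow> ((\<lambda>y. f x y) has_real_derivative fy x y) (at y)"
    and cont: "continuous_on ({a<..<b} \<times> {c<..<d}) (\<lambda>(x, y). fy x y)"
    and xy: "x \<in> {a<..<b}" "y \<in> {c<..<d}"
  shows "((\<lambda>(x, y). f x y) has_derivative (\<lambda>(h, k). fx x y * h + fy x y * k)) (at (x, y))"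
proof -
  let ?X = "{a<..<b}" and ?Y = "{c<..<d}"
  have "((\<lambda>(x, y). f x y) has_derivative
      (\<lambda>(h, k). fx x y * h + blinfun_apply (blinfun_mult_right (fy x y)) k)) (at (x, y) within ?X \<times> ?Y)"
  proof (rule has_derivative_partialsI)
    show "((\<lambda>x. f x y) has_derivative (\<lambda>h. fx x y * h)) (at x within ?X)"
      using fx[OF xy] by (simp add: has_field_derivative_def has_derivative_at_withinI)
    show "((\<lambda>y. f x y) has_derivative blinfun_apply (blinfun_mult_right (fy x y))) (at y within ?Y)"
      if "x \<in> ?X" "y \<in> ?Y" for x y
      using fy[OF that] by (simp add: has_field_derivative_def has_derivative_at_withinI)
    have "continuous_on (?X \<times> ?Y) (\<lambda>(x, y). blinfun_mult_right (fy x y))"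
      using cont by (auto simp: split_beta intro!: continuous_intros)
    then show "continuous (at (x, y) within ?X \<times> ?Y) (\<lambda>(x, y). blinfun_mult_right (fy x y))"
      using xy by (auto simp: continuous_on_eq_continuous_within)
  qed (use xy in auto)
  moreover have "at (x, y) within ?X \<times> ?Y = at (x, y)"
    using xy by (intro at_within_open open_Times) auto
  ultimately show ?thesis
    by simp
qed

lemma holomorphic_on_rectangle_of_Cauchy_Riemann:
  fixes f g :: "real \<Rightarrow> real \<Rightarrow> real"
  assumes fx: "\<And>x y. x \<in> {a<..<b} \<Longrightarrow> y \<in> {c<..<d} \<Longrightarrow> ((\<lambda>x. f x y) has_real_derivative p x y) (at x)"
    and fy: "\<And>x y. x \<in> {a<..<b} \<Longrightarrow> y \<in> {c<..<d} \<Longrightarrow> ((\<lambda>y. f x y) has_real_derivative q x y) (at y)"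
    and gx: "\<And>x y. x \<in> {a<..<b} \<Longrightarrow> y \<in> {c<..<d} \<Longrightarrow> ((\<lambda>x. g x y) has_real_derivative - q x y) (at x)"
    and gy: "\<And>x y. x \<in> {a<..<b} \<Longrightarrow> y \<in> {c<..<d} \<Longrightarrow> ((\<lambda>y. g x y) has_real_derivative p x y) (at y)"
    and contp: "continuous_on ({a<..<b} \<times> {c<..<d}) (\<lambda>(x, y). p x y)"
    and contq: "continuous_on ({a<..<b} \<times> {c<..<d}) (\<lambda>(x, y). q x y)"
  shows "(\<lambda>z. Complex (f (Re z) (Im z)) (g (Re z) (Im z))) holomorphic_on box (Complex a c) (Complex b d)"
proof -
  let ?F = "\<lambda>z. Complex (f (Re z) (Im z)) (g (Re z) (Im z))"
  have "(?F has_field_derivative Complex (p (Re z) (Im z)) (- q (Re z) (Im z))) (at z)"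
    if z: "z \<in> box (Complex a c) (Complex b d)" for z
  proof -
    have xy: "Re z \<in> {a<..<b}" "Im z \<in> {c<..<d}"
      using z by (auto simp: in_box_complex_iff)
    have coord: "((\<lambda>z. (Re z, Im z)) has_derivative (\<lambda>h. (Re h, Im h))) (at z)"
      by (auto intro!: derivative_eq_intros)
    have df: "((\<lambda>z. f (Re z) (Im z)) has_derivative (\<lambda>h. p (Re z) (Im z) * Re h + q (Re z) (Im z) * Im h)) (at z)"
      using has_derivative_compose[OF coord has_derivative_of_continuous_partials[OF fx fy contq xy]]
      by simp
    have dg: "((\<lambda>z. g (Re z) (Im z)) has_derivative (\<lambda>h. - q (Re z) (Im z) * Re h + p (Re z) (Im z) * Im h)) (at z)"
      using has_derivative_compose[OF coord has_derivative_of_continuous_partials[OF gx gy contp xy]]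
      by simp
    have "(?F has_derivative (\<lambda>h. Complex (p (Re z) (Im z) * Re h + q (Re z) (Im z) * Im h)
        (- q (Re z) (Im z) * Re h + p (Re z) (Im z) * Im h))) (at z)"
      unfolding Complex_eq by (intro derivative_intros df dg)
    also have "(\<lambda>h. Complex (p (Re z) (Im z) * Re h + q (Re z) (Im z) * Im h)
        (- q (Re z) (Im z) * Re h + p (Re z) (Im z) * Im h)) = (*) (Complex (p (Re z) (Im z)) (- q (Re z) (Im z)))"
      by (auto simp: complex_eq_iff fun_eq_iff)
    finally show ?thesis
      by (simp add: has_field_derivative_def)
  qed
  then show ?thesis
    by (meson has_field_derivative_at_within holomorphic_onI field_differentiable_def)
qed

text \<open>
  The conjugate is the integral of \<open>- f\<^sub>y dx + f\<^sub>x dy\<close> along the path from the corner \<open>(a, c)\<close> that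
  first runs along the bottom edge and then vertically. With this choice the vertical derivative
  is immediate, and the horizontal one follows by differentiating under the integral and replacing
  \<open>f\<^sub>x\<^sub>x\<close> by \<open>- f\<^sub>y\<^sub>y\<close>. Here \<open>p\<close>, \<open>q\<close>, \<open>pp\<close>, \<open>qq\<close> are the values of \<open>f\<^sub>x\<close>, \<open>f\<^sub>y\<close>, \<open>f\<^sub>x\<^sub>x\<close>, \<open>f\<^sub>y\<^sub>y\<close>.
\<close>

lemma harmonic_conjugate_on_rectangle:
  fixes f p q pp qq :: "real \<Rightarrow> real \<Rightarrow> real"
  assumes fx: "\<And>x y. x \<in> {a..b} \<Longrightarrow> y \<in> {c..d} \<Longrightarrow> ((\<lambda>x. f x y) has_real_derivative p x y) (at x)"
    and fy: "\<And>x y. x \<in> {a..b} \<Longrightarrow> y \<in> {c..d} \<Longrightarrow> ((\<lambda>y. f x y) has_real_derivative q x y) (at y)"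
    and fxx: "\<And>x y. x \<in> {a..b} \<Longrightarrow> y \<in> {c..d} \<Longrightarrow> ((\<lambda>x. p x y) has_real_derivative pp x y) (at x)"
    and fyy: "\<And>x y. x \<in> {a..b} \<Longrightarrow> y \<in> {c..d} \<Longrightarrow> ((\<lambda>y. q x y) has_real_derivative qq x y) (at y)"
    and contp: "continuous_on ({a..b} \<times> {c..d}) (\<lambda>(x, y). p x y)"
    and contq: "continuous_on ({a..b} \<times> {c..d}) (\<lambda>(x, y). q x y)"
    and contpp: "continuous_on ({a..b} \<times> {c..d}) (\<lambda>(x, y). pp x y)"
    and laplace: "\<And>x y. x \<in> {a..b} \<Longrightarrow> y \<in> {c..d} \<Longrightarrow> pp x y + qq x y = 0"
  obtains F where "F holomorphic_on box (Complex a c) (Complex b d)"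
    and "\<And>z. Re (F z) = f (Re z) (Im z)"
proof -
  define g where "g x y = integral {c..y} (p x) - integral {a..x} (\<lambda>x. q x c)" for x y
  have cont_y: "continuous_on {c..d} (p x)" if "x \<in> {a..b}" for x
    using that by (intro continuous_on_compose2[OF contp, of _ "\<lambda>y. (x, y)", simplified]) (auto intro!: continuous_intros)
  have cont_x: "continuous_on {a..b} (\<lambda>x. q x c)" if "c \<le> d"
    using that by (intro continuous_on_compose2[OF contq, of _ "\<lambda>x. (x, c)", simplified]) (auto intro!: continuous_intros)
  have gy: "((\<lambda>y. g x y) has_real_derivative p x y) (at y)" if "x \<in> {a<..<b}" "y \<in> {c<..<d}" for x y
  proof -
    have "((\<lambda>y. integral {c..y} (p x)) has_real_derivative p x y) (at y within {c..d})"
      using that by (intro integral_has_real_derivative cont_y) auto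
    then have "((\<lambda>y. integral {c..y} (p x)) has_real_derivative p x y) (at y)"
      using that by (simp add: at_within_Icc_at)
    then show ?thesis
      unfolding g_def by (auto intro!: derivative_eq_intros)
  qed
  have gx: "((\<lambda>x. g x y) has_real_derivative - q x y) (at x)" if xy: "x \<in> {a<..<b}" "y \<in> {c<..<d}" for x y
  proof -
    have "((\<lambda>x. integral (cbox c y) (p x)) has_real_derivative integral (cbox c y) (pp x)) (at x within {a..b})"
    proof (rule leibniz_rule_field_derivative)
      show "((\<lambda>x. p x t) has_real_derivative pp x t) (at x within {a..b})"
        if "x \<in> {a..b}" "t \<in> cbox c y" for x t
        using fxx[of x t] that xy by (simp add: has_field_derivative_at_within)
      show "p x integrable_on cbox c y" if "x \<in> {a..b}" for x
        using continuous_on_subset[OF cont_y[OF that], of "{c..y}"] xy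
        by (auto intro!: integrable_continuous_real)
      show "continuous_on ({a..b} \<times> cbox c y) (\<lambda>(x, t). pp x t)"
        using xy by (auto intro!: continuous_on_subset[OF contpp])
    qed (use xy in auto)
    \<comment> \<open>The Laplace equation makes the integrand a vertical derivative.\<close>
    moreover have "integral (cbox c y) (pp x) = - (q x y - q x c)"
    proof -
      have "(qq x has_integral q x y - q x c) {c..y}"
      proof (rule fundamental_theorem_of_calculus[where f = "q x"])
        fix t assume "t \<in> {c..y}"
        then have "((\<lambda>y. q x y) has_real_derivative qq x t) (at t within {c..y})"
          using fyy[of x t] xy by (simp add: has_field_derivative_at_within)
        then show "(q x has_vector_derivative qq x t) (at t within {c..y})"
          by (simp add: has_real_derivative_iff_has_vector_derivative)
      qed (use xy in auto)
      then have "((\<lambda>t. - qq x t) has_integral - (q x y - q x c)) {c..y}"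
        by (rule has_integral_neg)
      moreover have "- qq x t = pp x t" if "t \<in> {c..y}" for t
        using laplace[of x t] xy that by auto
      ultimately have "(pp x has_integral - (q x y - q x c)) {c..y}"
        by (rule has_integral_eq[rotated])
      then show ?thesis
        by (simp add: integral_unique)
    qed
    ultimately have "((\<lambda>x. integral {c..y} (p x)) has_real_derivative - (q x y - q x c)) (at x)"
      using xy by (simp add: at_within_Icc_at)
    moreover have "((\<lambda>x. integral {a..x} (\<lambda>x. q x c)) has_real_derivative q x c) (at x within {a..b})"
      using xy by (intro integral_has_real_derivative cont_x) auto
    then have "((\<lambda>x. integral {a..x} (\<lambda>x. q x c)) has_real_derivative q x c) (at x)"
      using xy by (simp add: at_within_Icc_at)
    ultimately show ?thesis
      unfolding g_def by (auto intro!: derivative_eq_intros)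
  qed
  have sub: "{a<..<b} \<times> {c<..<d} \<subseteq> {a..b} \<times> {c..d}"
    by auto
  have "(\<lambda>z. Complex (f (Re z) (Im z)) (g (Re z) (Im z))) holomorphic_on box (Complex a c) (Complex b d)"
    by (rule holomorphic_on_rectangle_of_Cauchy_Riemann[OF fx fy gx gy
          continuous_on_subset[OF contp sub] continuous_on_subset[OF contq sub]]) auto
  then show thesis
    by (rule that) simp
qed

section \<open>Harmonic functions as real parts of holomorphic functions\<close>

definition point_of :: "complex \<Rightarrow> real^2" where
  "point_of z = vector [Re z, Im z]"

lemma point_of_nth [simp]: "point_of z $ 1 = Re z" "point_of z $ 2 = Im z"
  by (simp_all add: point_of_def)

lemma point_of_Complex [simp]: "point_of (Complex (x $ 1) (x $ 2)) = x"
  by (simp add: vec_eq_iff forall_2)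

lemma continuous_on_point_of: "continuous_on S point_of"
proof -
  have "continuous_on S (\<lambda>z. if i = (1::2) then Re z else Im z)" for i
    by (cases "i = 1") (auto intro!: continuous_intros)
  then have "continuous_on S (\<lambda>z. \<chi> i. if i = (1::2) then Re z else Im z)"
    by (rule continuous_on_vec_lambda)
  also have "(\<lambda>z. \<chi> i. if i = (1::2) then Re z else Im z) = point_of"
    by (auto simp: vec_eq_iff forall_2 fun_eq_iff)
  finally show ?thesis .
qed

lemma has_partial_at_DERIV:
  assumes "has_partial_at i u x"
  shows "((\<lambda>t. u (x + t *\<^sub>R axis i 1)) has_real_derivative partial i u x) (at 0)"
  using assms unfolding has_partial_at_def partial_def
  by (simp add: DERIV_deriv_iff_real_differentiable)

lemma has_partial_at_DERIV_fst:
  assumes "has_partial_at 1 u (point_of (Complex x y))"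
  shows "((\<lambda>x. u (point_of (Complex x y))) has_real_derivative partial 1 u (point_of (Complex x y))) (at x)"
proof -
  have "point_of (Complex x y) + t *\<^sub>R axis 1 1 = point_of (Complex (t + x) y)" for t
    by (simp add: vec_eq_iff forall_2 axis_def)
  with has_partial_at_DERIV[OF assms] show ?thesis
    using DERIV_shift[of "\<lambda>x. u (point_of (Complex x y))" _ 0 x] by simp
qed

lemma has_partial_at_DERIV_snd:
  assumes "has_partial_at 2 u (point_of (Complex x y))"
  shows "((\<lambda>y. u (point_of (Complex x y))) has_real_derivative partial 2 u (point_of (Complex x y))) (at y)"
proof -
  have "point_of (Complex x y) + t *\<^sub>R axis 2 1 = point_of (Complex x (t + y))" for t
    by (simp add: vec_eq_iff forall_2 axis_def)
  with has_partial_at_DERIV[OF assms] show ?thesis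
    using DERIV_shift[of "\<lambda>y. u (point_of (Complex x y))" _ 0 y] by simp
qed

lemma harmonic_locally_Re_holomorphic:
  fixes u :: "real^2 \<Rightarrow> real"
  assumes "open \<Omega>" "harmonic_on u \<Omega>" "point_of z0 \<in> \<Omega>"
  obtains S F where "open S" "z0 \<in> S" "F holomorphic_on S" "\<And>z. z \<in> S \<Longrightarrow> Re (F z) = u (point_of z)"
proof -
  have "open (point_of -` \<Omega>)"
    using \<open>open \<Omega>\<close> by (intro open_vimage continuous_on_point_of)
  then obtain l r where box: "z0 \<in> box l r" "cbox l r \<subseteq> point_of -` \<Omega>"
    using assms(3) by (metis open_contains_cbox vimageI2)
  define a b c d where "a = Re l" and "b = Re r" and "c = Im l" and "d = Im r"
  have lr: "l = Complex a c" "r = Complex b d"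
    by (simp_all add: a_def b_def c_def d_def)
  have sub: "point_of (Complex x y) \<in> \<Omega>" if "x \<in> {a..b}" "y \<in> {c..d}" for x y
    using box(2) that by (auto simp: lr in_cbox_complex_iff subset_iff)
  have C2: "Ck_on (Suc (Suc 0)) u \<Omega>" and lap: "\<And>x. x \<in> \<Omega> \<Longrightarrow> laplacian u x = 0"
    using assms(2) by (simp_all add: harmonic_on_def numeral_2_eq_2)
  have cont: "continuous_on ({a..b} \<times> {c..d}) (\<lambda>(x, y). h (point_of (Complex x y)))"
    if "continuous_on \<Omega> h" for h :: "real^2 \<Rightarrow> real"
  proof -
    have "continuous_on ({a..b} \<times> {c..d}) (\<lambda>w. Complex (fst w) (snd w))"
      unfolding Complex_eq by (intro continuous_intros)
    then have "continuous_on ({a..b} \<times> {c..d}) (\<lambda>w. point_of (Complex (fst w) (snd w)))"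
      by (rule continuous_on_compose2[OF continuous_on_point_of[of UNIV]]) simp
    moreover have "(\<lambda>w. point_of (Complex (fst w) (snd w))) ` ({a..b} \<times> {c..d}) \<subseteq> \<Omega>"
      using sub by auto
    ultimately show ?thesis
      using continuous_on_compose2[OF that] by (simp add: split_beta)
  qed
  obtain F where F: "F holomorphic_on box (Complex a c) (Complex b d)"
    and ReF: "\<And>z. Re (F z) = u (point_of (Complex (Re z) (Im z)))"
  proof (rule harmonic_conjugate_on_rectangle)
    fix x y assume "x \<in> {a..b}" "y \<in> {c..d}"
    then have "point_of (Complex x y) \<in> \<Omega>"
      by (rule sub)
    with C2 have part: "has_partial_at 1 u (point_of (Complex x y))" "has_partial_at 2 u (point_of (Complex x y))"
      "has_partial_at 1 (partial 1 u) (point_of (Complex x y))" "has_partial_at 2 (partial 2 u) (point_of (Complex x y))"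
      by simp_all
    show
      "((\<lambda>x. u (point_of (Complex x y))) has_real_derivative partial 1 u (point_of (Complex x y))) (at x)"
      "((\<lambda>y. u (point_of (Complex x y))) has_real_derivative partial 2 u (point_of (Complex x y))) (at y)"
      "((\<lambda>x. partial 1 u (point_of (Complex x y))) has_real_derivative
          partial 1 (partial 1 u) (point_of (Complex x y))) (at x)"
      "((\<lambda>y. partial 2 u (point_of (Complex x y))) has_real_derivative
          partial 2 (partial 2 u) (point_of (Complex x y))) (at y)"
      by (fact has_partial_at_DERIV_fst[OF part(1)] has_partial_at_DERIV_snd[OF part(2)]
          has_partial_at_DERIV_fst[OF part(3)] has_partial_at_DERIV_snd[OF part(4)])+
    show "partial 1 (partial 1 u) (point_of (Complex x y)) + partial 2 (partial 2 u) (point_of (Complex x y)) = 0"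
      using lap[OF \<open>point_of (Complex x y) \<in> \<Omega>\<close>] by (simp add: laplacian_def sum_2)
  qed (use C2 in \<open>simp_all add: cont\<close>)
  show thesis
  proof
    show "z0 \<in> box l r" by fact
    show "F holomorphic_on box l r" using F by (simp add: lr)
  qed (auto simp: ReF)
qed

section \<open>Zeros along analytic curves\<close>

text \<open>
  The identity theorem needs complex parameters. Since \<open>Re (F (\<gamma> z))\<close> is in general not holomorphic
  in \<open>z\<close>, its restriction to the real line is extended in another way: half the sum of
  \<open>F (\<gamma> z)\<close> and its reflection \<open>cnj (F (\<gamma> (cnj z)))\<close> in the real axis is holomorphic and has the same
  values at real \<open>z\<close>.
\<close>

lemma harmonic_zero_along_analytic_curve:
  fixes u :: "real^2 \<Rightarrow> real" and \<gamma> :: "complex \<Rightarrow> complex"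
  assumes "open \<Omega>" "harmonic_on u \<Omega>" and \<gamma>: "\<gamma> holomorphic_on UNIV"
    and t0: "point_of (\<gamma> (of_real t0)) \<in> \<Omega>"
    and lim: "t0 islimpt {t. u (point_of (\<gamma> (of_real t))) = 0}"
  obtains e where "e > 0" "\<And>t. \<bar>t - t0\<bar> < e \<Longrightarrow> u (point_of (\<gamma> (of_real t))) = 0"
proof -
  obtain S F where S: "open S" "\<gamma> (of_real t0) \<in> S" and F: "F holomorphic_on S"
    and ReF: "\<And>z. z \<in> S \<Longrightarrow> Re (F z) = u (point_of z)"
    using harmonic_locally_Re_holomorphic[OF assms(1,2) t0] by blast
  have "open (\<gamma> -` S)"
    using S(1) \<gamma> by (intro open_vimage holomorphic_on_imp_continuous_on)
  then obtain e where e: "e > 0" "ball (of_real t0) e \<subseteq> \<gamma> -` S"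
    using S(2) by (metis open_contains_ball vimageI2)
  let ?B = "ball (complex_of_real t0) e"
  define \<phi> where "\<phi> = F \<circ> \<gamma>"
  define G where "G z = \<phi> z + cnj (\<phi> (cnj z))" for z
  have \<phi>: "\<phi> holomorphic_on ?B"
    unfolding \<phi>_def using e(2) by (intro holomorphic_on_compose_gen[OF holomorphic_on_subset[OF \<gamma>] F]) auto
  have cnjB: "cnj ` ?B = ?B"
  proof -
    have "cnj z \<in> ?B" if "z \<in> ?B" for z
      using that by (metis complex_cnj_complex_of_real complex_cnj_diff complex_mod_cnj dist_norm mem_ball)
    then show ?thesis
      by (auto intro!: image_eqI[of _ cnj "cnj _"])
  qed
  have "cnj \<circ> \<phi> \<circ> cnj holomorphic_on ?B"
    using \<phi> cnjB by (intro holomorphic_on_compose_cnj_cnj) (auto)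
  then have G: "G holomorphic_on ?B"
    unfolding G_def using \<phi> by (intro holomorphic_intros) (auto simp: o_def)
  have G_real: "G (of_real t) = of_real (2 * u (point_of (\<gamma> (of_real t))))" if "\<bar>t - t0\<bar> < e" for t
  proof -
    have "of_real t \<in> ?B"
      using that by (simp add: dist_norm norm_minus_commute flip: of_real_diff)
    then have "\<gamma> (of_real t) \<in> S"
      using e(2) by blast
    then show ?thesis
      by (simp add: G_def \<phi>_def complex_add_cnj ReF)
  qed
  let ?Z = "complex_of_real ` {t. \<bar>t - t0\<bar> < e \<and> u (point_of (\<gamma> (of_real t))) = 0}"
  have "complex_of_real t0 islimpt ?Z"
    unfolding islimpt_approachable
  proof (intro allI impI)
    fix d :: real assume "d > 0"
    then obtain t where "u (point_of (\<gamma> (of_real t))) = 0" "t \<noteq> t0" "dist t t0 < min d e"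
      using lim e(1) unfolding islimpt_approachable by (metis (mono_tags) mem_Collect_eq min_less_iff_conj)
    then show "\<exists>z\<in>?Z. z \<noteq> complex_of_real t0 \<and> dist z (of_real t0) < d"
      by (intro bexI[of _ "of_real t"]) (auto simp: dist_real_def dist_norm simp flip: of_real_diff)
  qed
  moreover have "?Z \<subseteq> ?B"
    by (auto simp: dist_norm norm_minus_commute simp flip: of_real_diff)
  moreover have "G z = 0" if "z \<in> ?Z" for z
    using that G_real by auto
  ultimately have G0: "G z = 0" if "z \<in> ?B" for z
    using analytic_continuation[OF G _ _ _ _ _ _ that, of ?Z "of_real t0"] e(1) by auto
  show thesis
  proof
    fix t assume t: "\<bar>t - t0\<bar> < e"
    then have "of_real t \<in> ?B"
      by (simp add: dist_norm norm_minus_commute flip: of_real_diff)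
    from G0[OF this] G_real[OF t] show "u (point_of (\<gamma> (of_real t))) = 0"
      by simp
  qed fact
qed

section \<open>Parabolas\<close>

lemma infdist_hyperplane:
  fixes m :: "'a::euclidean_space"
  assumes "norm m = 1"
  shows "infdist x {y. m \<bullet> y = \<beta>} = \<bar>m \<bullet> x - \<beta>\<bar>"
proof (rule antisym)
  let ?L = "{y. m \<bullet> y = \<beta>}" and ?y = "x - (m \<bullet> x - \<beta>) *\<^sub>R m"
  have mm: "m \<bullet> m = 1"
    using assms by (simp add: norm_eq_1)
  then have y: "?y \<in> ?L"
    by (simp add: inner_diff_right)
  show "infdist x ?L \<le> \<bar>m \<bullet> x - \<beta>\<bar>"
    using infdist_le[OF y, of x] assms by (simp add: dist_norm)
  have "\<bar>m \<bullet> x - \<beta>\<bar> \<le> dist x y" if "y \<in> ?L" for y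
    using that Cauchy_Schwarz_ineq2[of m "x - y"] assms by (simp add: dist_norm inner_diff_right)
  then show "\<bar>m \<bullet> x - \<beta>\<bar> \<le> infdist x ?L"
    using y by (auto simp: infdist_def intro!: cINF_greatest)
qed

text \<open>
  Use orthonormal coordinates \<open>(s, r)\<close> centred at the focus, with \<open>r\<close> measured along the unit normal \<open>m\<close>
  of the directrix, and let \<open>h \<noteq> 0\<close> be the signed distance of the focus from the directrix. The
  squared equation of the parabola reads \<open>s\<^sup>2 + r\<^sup>2 = (r + h)\<^sup>2\<close>. The terms \<open>r\<^sup>2\<close> cancel, and since
  \<open>h \<noteq> 0\<close>, the coordinate \<open>r\<close> is a quadratic polynomial in \<open>s\<close>. In complex notation the
  direction of the \<open>s\<close>-axis is \<open>\<i>\<close> times that of the normal.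
\<close>

lemma parabola_parametrization:
  assumes "parabola P"
  obtains a b c :: complex and s :: "real^2 \<Rightarrow> real"
  where "continuous_on UNIV s"
    and "\<And>x. x \<in> P \<Longrightarrow> point_of (a + of_real (s x) * b + of_real ((s x)\<^sup>2) * c) = x"
proof -
  obtain F L where L: "affine L" "aff_dim L = 1" "F \<notin> L" and P: "P = {x. dist x F = infdist x L}"
    using assms unfolding parabola_def by blast
  obtain n k where n: "n \<noteq> 0" "L = {x. n \<bullet> x = k}"
    using aff_dim_eq_hyperplane[of L] L by (auto simp: affine_hull_eq[THEN iffD2])
  define m where "m = n /\<^sub>R norm n"
  define \<beta> where "\<beta> = k / norm n"
  have m: "norm m = 1"
    using n(1) by (simp add: m_def)
  have Lm: "L = {x. m \<bullet> x = \<beta>}"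
    using n by (auto simp: m_def \<beta>_def field_simps)
  define h where "h = m \<bullet> F - \<beta>"
  have h: "h \<noteq> 0"
    using L(3) by (auto simp: Lm h_def)
  define s where "s x = m $ 1 * (x $ 2 - F $ 2) - m $ 2 * (x $ 1 - F $ 1)" for x :: "real^2"
  define w where "w = Complex (m $ 1) (m $ 2)"
  show thesis
  proof
    show "continuous_on UNIV s"
      unfolding s_def by (intro continuous_intros)
    fix x assume "x \<in> P"
    then have "(dist x F)\<^sup>2 = (m \<bullet> x - \<beta>)\<^sup>2"
      by (simp add: P Lm infdist_hyperplane[OF m])
    then have eq: "(x $ 1 - F $ 1)\<^sup>2 + (x $ 2 - F $ 2)\<^sup>2 = (m $ 1 * x $ 1 + m $ 2 * x $ 2 - \<beta>)\<^sup>2"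
      by (simp add: dist_norm norm_eq_sqrt_inner inner_vec_def sum_2 power2_eq_square)
    have mm: "(m $ 1)\<^sup>2 + (m $ 2)\<^sup>2 = 1"
      using m by (simp add: norm_eq_1 inner_vec_def sum_2 power2_eq_square)
    have hm: "h = m $ 1 * F $ 1 + m $ 2 * F $ 2 - \<beta>"
      by (simp add: h_def inner_vec_def sum_2)
    define r where "r = m $ 1 * (x $ 1 - F $ 1) + m $ 2 * (x $ 2 - F $ 2)"
    \<comment> \<open>Rotating \<open>x - F\<close> preserves its length.\<close>
    have "(s x)\<^sup>2 + r\<^sup>2 = ((m $ 1)\<^sup>2 + (m $ 2)\<^sup>2) * ((x $ 1 - F $ 1)\<^sup>2 + (x $ 2 - F $ 2)\<^sup>2)"
      by (simp add: s_def r_def power2_eq_square algebra_simps)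
    also have "\<dots> = (r + h)\<^sup>2"
      unfolding mm eq by (simp add: r_def hm algebra_simps)
    finally have "(s x)\<^sup>2 = 2 * h * r + h\<^sup>2"
      by (simp add: power2_eq_square algebra_simps)
    then have r: "r = (s x)\<^sup>2 / (2 * h) - h / 2"
      using h by (simp add: field_simps power2_eq_square)
    have "x $ 1 - F $ 1 = ((m $ 1)\<^sup>2 + (m $ 2)\<^sup>2) * (x $ 1 - F $ 1)"
      "x $ 2 - F $ 2 = ((m $ 1)\<^sup>2 + (m $ 2)\<^sup>2) * (x $ 2 - F $ 2)"
      by (simp_all add: mm)
    then have x: "x $ 1 = F $ 1 + r * m $ 1 - s x * m $ 2" "x $ 2 = F $ 2 + r * m $ 2 + s x * m $ 1"
      by (simp_all add: r_def s_def power2_eq_square algebra_simps)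
    show "point_of ((Complex (F $ 1) (F $ 2) - of_real (h / 2) * w) + of_real (s x) * (\<i> * w)
        + of_real ((s x)\<^sup>2) * (of_real (1 / (2 * h)) * w)) = x"
      by (simp add: vec_eq_iff forall_2 x r w_def algebra_simps del: of_real_power)
  qed
qed

section \<open>Propagation of zeros along the parabola\<close>

theorem corollary2p1:
  fixes \<Omega> \<Gamma> \<tau> T :: "(real^2) set"
    and u :: "real^2 \<Rightarrow> real"
    and M :: real
  assumes "open \<Omega>" and "connected \<Omega>" and "\<Omega> \<noteq> {}"
    and "\<Gamma> \<subseteq> \<Omega>" and "connected_piece_of_parabola \<Gamma>"
    and "open_curve_in \<tau> \<Gamma>" and "open_curve_in T \<Gamma>"
    and "\<tau> \<subseteq> T" and "compactly_contained T \<Gamma>"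
    and "Ck_on 2 u \<Omega>" and "harmonic_on u \<Omega>"
    and "M > 0" and "C_norm \<Omega> u \<le> ereal M"
    and "\<forall>x\<in>\<tau>. u x = 0"
  shows "\<forall>x\<in>T. u x = 0"
proof -
  obtain P where P: "parabola P" "\<Gamma> \<subseteq> P" and "connected \<Gamma>"
    using assms(5) unfolding connected_piece_of_parabola_def by blast
  obtain a b c s where s: "continuous_on UNIV s"
    and param: "\<And>x. x \<in> P \<Longrightarrow> point_of (a + of_real (s x) * b + of_real ((s x)\<^sup>2) * c) = x"
    by (rule parabola_parametrization[OF P(1)]) (rule that)
  define \<gamma> where "\<gamma> z = a + z * b + z\<^sup>2 * c" for z
  have \<gamma>: "\<gamma> holomorphic_on UNIV"
    unfolding \<gamma>_def by (intro holomorphic_intros)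
  have \<gamma>_s: "point_of (\<gamma> (of_real (s x))) = x" if "x \<in> \<Gamma>" for x
    using param[of x] that P(2) by (auto simp: \<gamma>_def)
  define A where "A = {x \<in> \<Gamma>. \<exists>U. open U \<and> x \<in> U \<and> (\<forall>y\<in>\<Gamma> \<inter> U. u y = 0)}"
  have zero: "u x = 0" if "x \<in> A" for x
    using that by (auto simp: A_def)
  have "openin (top_of_set \<Gamma>) A"
    unfolding openin_subopen[of _ A] by (auto simp: A_def openin_open) 
  moreover have "closedin (top_of_set \<Gamma>) A"
  proof -
    have "x \<in> A" if x: "x \<in> \<Gamma>" "x islimpt A" for x
    proof -
      have "s x islimpt {t. u (point_of (\<gamma> (of_real t))) = 0}"
      proof -
        \<comment> \<open>The parameter \<open>s\<close> is injective on \<open>\<Gamma>\<close>, so it maps zeros other than \<open>x\<close> to parameters other than \<open>s x\<close>.\<close>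
        obtain f where f: "\<And>n. f n \<in> A - {x}" "f \<longlonglongrightarrow> x"
          using x(2) unfolding islimpt_sequential by blast
        have "s (f n) \<in> {t. u (point_of (\<gamma> (of_real t))) = 0} - {s x}" for n
          using f(1)[of n] zero[of "f n"] \<gamma>_s[of "f n"] \<gamma>_s[OF x(1)] by (auto simp: A_def)
        moreover have "(\<lambda>n. s (f n)) \<longlonglongrightarrow> s x"
          using s f(2) by (rule continuous_on_tendsto_compose) auto
        ultimately show ?thesis
          unfolding islimpt_sequential by (intro exI[of _ "\<lambda>n. s (f n)"]) blast
      qed
      then obtain e where e: "e > 0" "\<And>t. \<bar>t - s x\<bar> < e \<Longrightarrow> u (point_of (\<gamma> (of_real t))) = 0"
        using harmonic_zero_along_analytic_curve[OF assms(1,11) \<gamma>, of "s x"] \<gamma>_s[OF x(1)] x(1) assms(4)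
        by (metis subsetD)
      have "open (s -` ball (s x) e)"
        using s by (intro open_vimage) auto
      moreover have "u y = 0" if "y \<in> \<Gamma> \<inter> s -` ball (s x) e" for y
        using e(2)[of "s y"] \<gamma>_s[of y] that by (auto simp: dist_real_def)
      ultimately show ?thesis
        using x(1) e(1) unfolding A_def by (auto intro!: exI[of _ "s -` ball (s x) e"])
    qed
    then show ?thesis
      by (auto simp: closedin_limpt A_def)
  qed
  moreover have "\<tau> \<subseteq> A" "\<tau> \<noteq> {}"
    using assms(6,14) by (auto simp: open_curve_in_def A_def openin_open)
  ultimately have "A = \<Gamma>"
    using \<open>connected \<Gamma>\<close> by (auto simp: connected_clopen)
  moreover have "T \<subseteq> \<Gamma>"
    using assms(7) by (auto simp: open_curve_in_def openin_open)
  ultimately show ?thesis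
    using zero by blast
qed

end
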